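(* There is a function $\varepsilon(n)\to 0$ (as $n\to\infty$) such that, for the random graph $G\sim G(n,1/2)$, $$\Pr\left[\pi(G)\le n^{(1+\varepsilon(n))\log_2 n}\right]\to 1\quad\text{as } n\to\infty .$$
   Context: $G(n,1/2)$ is the random graph on $n$ labelled vertices in which each of the $\binom n2$ possible edges is present independently with probability $1/2$. $k(G)$ is the number of cliques of $G$ (vertex subsets inducing a complete subgraph) and $i(G)$ is the number of independent sets of $G$; the empty set and all singletons count both as cliques and as independent sets. $\pi(G)=i(G)\,k(G)$. *)

theory Defs
  imports "HOL-Probability.Probability"
begin

text \<open>A finite simple graph is given by its vertex set \<open>V\<close> and its edge set \<open>E\<close>, the
  edges being two-element subsets of \<open>V\<close>.\<close>

definition all_edges :: "'a set \<Rightarrow> 'a set set" where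
  "all_edges V = {e. e \<subseteq> V \<and> card e = 2}"

definition is_clique :: "'a set \<Rightarrow> 'a set set \<Rightarrow> 'a set \<Rightarrow> bool" where
  "is_clique V E S \<longleftrightarrow> S \<subseteq> V \<and> (\<forall>u\<in>S. \<forall>v\<in>S. u \<noteq> v \<longrightarrow> {u, v} \<in> E)"

definition is_indep :: "'a set \<Rightarrow> 'a set set \<Rightarrow> 'a set \<Rightarrow> bool" where
  "is_indep V E S \<longleftrightarrow> S \<subseteq> V \<and> (\<forall>u\<in>S. \<forall>v\<in>S. u \<noteq> v \<longrightarrow> {u, v} \<notin> E)"

definition num_cliques :: "'a set \<Rightarrow> 'a set set \<Rightarrow> nat" where
  "num_cliques V E = card {S. is_clique V E S}"

definition num_indep :: "'a set \<Rightarrow> 'a set set \<Rightarrow> nat" where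
  "num_indep V E = card {S. is_indep V E S}"

definition clique_indep_product :: "'a set \<Rightarrow> 'a set set \<Rightarrow> nat" where
  "clique_indep_product V E = num_indep V E * num_cliques V E"

text \<open>The law of the edge set of \<open>G(n,p)\<close> on the vertex set \<open>{1..n}\<close>: the indicators of the
  potential edges are independent Bernoulli variables with parameter \<open>p\<close>. The second argument
  of \<^const>\<open>Pi_pmf\<close> is the value of the indicator outside the set of potential edges.\<close>

definition random_graph :: "nat \<Rightarrow> real \<Rightarrow> nat set set pmf" where
  "random_graph n p =
     map_pmf (\<lambda>f. {e \<in> all_edges {1..n}. f e})
       (Pi_pmf (all_edges {1..n}) False (\<lambda>_. bernoulli_pmf p))"

end

(* First moment method. A set of s vertices is a clique with probability 2^(-s(s-1)/2), so with
   L = log_2 n the expected number of cliques is at most the sum over s <= n of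
   2^(sL - s(s-1)/2). Completing the square in s, each summand is at most 2^((L + 1/2)^2/2), so
   the expectation is n^(L/2 + O(1)). By Markov's inequality, with probability at least 1 - 1/n
   the number of cliques is at most n times this bound. The same holds for independent sets, and
   the product of the two bounds is n^(L + O(1)); hence epsilon(n) = O(1/L) works. *)

theory Submission
  imports Defs "HOL-Real_Asymp.Real_Asymp"
begin

text \<open>The count is a sum of indicators, so by linearity its expectation is the sum of the
  probabilities; Markov's inequality then bounds the tail.\<close>

lemma prob_card_Markov:
  fixes p :: "'a pmf" and P :: "'b \<Rightarrow> 'a \<Rightarrow> bool" and c :: real
  assumes "finite A" and "c > 0"
  shows "measure_pmf.prob p {x. c < real (card {a \<in> A. P a x})}
           \<le> (\<Sum>a\<in>A. measure_pmf.prob p {x. P a x}) / c"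
proof -
  have count: "real (card {a \<in> A. P a x}) = (\<Sum>a\<in>A. indicator {x. P a x} x)" for x
    using assms(1) by (simp add: indicator_def sum.If_cases Int_def)
  have integrable: "integrable p (\<lambda>x. indicator {x. P a x} x :: real)" for a
    by (rule measure_pmf.integrable_const_bound[where B = 1]) auto
  have "measure_pmf.prob p {x. c < real (card {a \<in> A. P a x})}
      \<le> measure_pmf.prob p {x \<in> space p. c \<le> real (card {a \<in> A. P a x})}"
    by (rule measure_pmf.finite_measure_mono) auto
  also have "\<dots> \<le> measure_pmf.expectation p (\<lambda>x. real (card {a \<in> A. P a x})) / c"
  proof (rule integral_Markov_inequality_measure[where A = "{}"])
    show "integrable p (\<lambda>x. real (card {a \<in> A. P a x}))"
      unfolding count using integrable by (intro Bochner_Integration.integrable_sum)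
  qed (use assms in auto)
  also have "measure_pmf.expectation p (\<lambda>x. real (card {a \<in> A. P a x}))
      = (\<Sum>a\<in>A. measure_pmf.prob p {x. P a x})"
    unfolding count using integrable by (subst Bochner_Integration.integral_sum) auto
  finally show ?thesis .
qed

lemma finite_all_edges: "finite V \<Longrightarrow> finite (all_edges V)"
  unfolding all_edges_def by (rule finite_subset[of _ "Pow V"]) auto

lemma card_all_edges: "finite V \<Longrightarrow> card (all_edges V) = card V choose 2"
  unfolding all_edges_def by (rule n_subsets)

lemma all_edges_mono: "S \<subseteq> V \<Longrightarrow> all_edges S \<subseteq> all_edges V"
  unfolding all_edges_def by auto

text \<open>Passing from pairs of vertices to edges turns cliques and independent sets into
  conditions on single coordinates of the product law.\<close>

lemma ball_all_edges_iff:
  "(\<forall>e\<in>all_edges S. Q e) \<longleftrightarrow> (\<forall>u\<in>S. \<forall>v\<in>S. u \<noteq> v \<longrightarrow> Q {u, v})"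
proof (intro iffI ballI impI)
  fix u v
  assume "\<forall>e\<in>all_edges S. Q e" "u \<in> S" "v \<in> S" "u \<noteq> v"
  then show "Q {u, v}"
    by (simp add: all_edges_def)
next
  fix e
  assume "\<forall>u\<in>S. \<forall>v\<in>S. u \<noteq> v \<longrightarrow> Q {u, v}" "e \<in> all_edges S"
  then show "Q e"
    by (auto simp: all_edges_def card_2_iff)
qed

lemma is_clique_iff: "is_clique V E S \<longleftrightarrow> S \<subseteq> V \<and> (\<forall>e\<in>all_edges S. e \<in> E)"
  unfolding is_clique_def ball_all_edges_iff ..

lemma is_indep_iff: "is_indep V E S \<longleftrightarrow> S \<subseteq> V \<and> (\<forall>e\<in>all_edges S. e \<notin> E)"
  unfolding is_indep_def ball_all_edges_iff ..

text \<open>Taking \<^term>\<open>b\<close> to be true gives cliques, taking it to be false independent sets.\<close>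

lemma prob_random_graph_uniform_on:
  assumes "S \<subseteq> {1..n}"
  shows "measure_pmf.prob (random_graph n (1/2)) {E. \<forall>e\<in>all_edges S. (e \<in> E) = b}
           = (1/2) ^ (card S choose 2)"
proof -
  define A where "A = all_edges {1..n}"
  \<comment> \<open>The event is a box: the coordinates of edges inside \<open>S\<close> are pinned
    to \<open>b\<close>, all others are free.\<close>
  define B where "B = (\<lambda>e. if e \<in> all_edges S then {b} else UNIV)"
  have fin: "finite A"
    unfolding A_def by (simp add: finite_all_edges)
  have sub: "all_edges S \<subseteq> A"
    unfolding A_def using assms by (rule all_edges_mono)
  have "measure_pmf.prob (random_graph n (1/2)) {E. \<forall>e\<in>all_edges S. (e \<in> E) = b}
      = measure_pmf.prob (Pi_pmf A False (\<lambda>_. bernoulli_pmf (1/2))) (Pi A B)"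
    unfolding random_graph_def A_def[symmetric] measure_map_pmf
    by (rule arg_cong[where f = "measure_pmf.prob _"])
      (use sub in \<open>auto simp: B_def Pi_def\<close>)
  also have "\<dots> = (\<Prod>e\<in>A. measure_pmf.prob (bernoulli_pmf (1/2)) (B e))"
    using fin by (rule measure_Pi_pmf_Pi)
  \<comment> \<open>With parameter 1/2 both values of \<open>b\<close> have the same probability, so
    one computation serves cliques and independent sets.\<close>
  also have "\<dots> = (\<Prod>e\<in>A. if e \<in> all_edges S then 1/2 else 1)"
    by (rule prod.cong) (cases b; auto simp: B_def measure_pmf_single)+
  also have "\<dots> = (\<Prod>e\<in>all_edges S. 1/2)"
    using fin sub by (simp add: prod.If_cases Int_absorb1)
  also have "\<dots> = (1/2) ^ (card S choose 2)"
    using finite_subset[OF assms] by (simp add: card_all_edges)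
  finally show ?thesis .
qed

lemma binomial_le_power: "n choose k \<le> n ^ k"
  by (cases "k \<le> n") (simp_all add: binomial_le_pow binomial_eq_0)

text \<open>The factor \<open>n + 1\<close> counts the sizes 0..n; the exponent is the maximum of
  \<open>s * L - s * (s - 1) / 2\<close> over real \<open>s\<close>, where
  \<open>L = log 2 n\<close>, attained at \<open>s = L + 1/2\<close>.\<close>

definition count_bound :: "nat \<Rightarrow> real" where
  "count_bound n = real (n + 1) * 2 powr ((log 2 n + 1/2)\<^sup>2 / 2)"

lemma power_mult_half_power_le:
  assumes "n \<ge> 1"
  shows "real n ^ s * (1/2) ^ (s choose 2) \<le> 2 powr ((log 2 n + 1/2)\<^sup>2 / 2)"
proof -
  define L where "L = log 2 (real n)"
  have choose: "real (s choose 2) = real s * (real s - 1) / 2"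
    by (cases s) (simp_all add: choose_two real_of_nat_div algebra_simps)
  have "real n ^ s = 2 powr (L * s)"
    using assms unfolding L_def by (simp add: powr_powr[symmetric] powr_realpow)
  moreover have "(1/2) ^ (s choose 2) = 2 powr (- real (s choose 2))"
    by (simp add: powr_minus powr_realpow power_one_over field_simps)
  ultimately have "real n ^ s * (1/2) ^ (s choose 2) = 2 powr (L * s - real s * (real s - 1) / 2)"
    by (simp add: powr_add[symmetric] choose)
  also have "\<dots> \<le> 2 powr ((L + 1/2)\<^sup>2 / 2)"
  proof (rule powr_mono)
    \<comment> \<open>Completing the square: the gap between the two exponents is half a
      square.\<close>
    have "(L + 1/2)\<^sup>2 / 2 - (L * s - real s * (real s - 1) / 2) = (L + 1/2 - s)\<^sup>2 / 2"
      by (simp add: power2_eq_square field_simps)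
    then show "L * s - real s * (real s - 1) / 2 \<le> (L + 1/2)\<^sup>2 / 2"
      by (metis diff_ge_0_iff_ge half_gt_zero_iff zero_le_power2 divide_nonneg_pos zero_less_numeral)
  qed simp
  finally show ?thesis
    unfolding L_def .
qed

text \<open>The left side is the expected number of cliques. Grouping by size gives
  \<open>n + 1\<close> terms, each controlled through \<open>n choose s \<le> n ^ s\<close>.\<close>

lemma sum_Pow_half_power_le:
  assumes "n \<ge> 1"
  shows "(\<Sum>S\<in>Pow {1..n}. (1/2) ^ (card S choose 2)) \<le> count_bound n"
proof -
  have "(\<Sum>S\<in>Pow {1..n}. (1/2::real) ^ (card S choose 2))
      = (\<Sum>s\<le>n. \<Sum>S\<in>{S \<in> Pow {1..n}. card S = s}. (1/2) ^ (card S choose 2))"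
    by (rule sum.group[symmetric]) (auto dest: card_mono[rotated])
  also have "\<dots> = (\<Sum>s\<le>n. real (n choose s) * (1/2) ^ (s choose 2))"
    by (rule sum.cong) (simp_all add: n_subsets)
  also have "\<dots> \<le> (\<Sum>s\<le>n. 2 powr ((log 2 n + 1/2)\<^sup>2 / 2))"
  proof (rule sum_mono)
    fix s
    have "real (n choose s) \<le> real n ^ s"
      using binomial_le_power[of n s] by (metis of_nat_le_iff of_nat_power)
    then have "real (n choose s) * (1/2) ^ (s choose 2) \<le> real n ^ s * (1/2) ^ (s choose 2)"
      by (rule mult_right_mono) simp
    also note power_mult_half_power_le[OF assms]
    finally show "real (n choose s) * (1/2) ^ (s choose 2) \<le> 2 powr ((log 2 n + 1/2)\<^sup>2 / 2)" .
  qed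
  also have "\<dots> = count_bound n"
    by (simp add: count_bound_def)
  finally show ?thesis .
qed

text \<open>The extra factor \<open>n\<close> in the threshold makes the failure probability vanish
  and adds only 1 to the exponent of \<open>n\<close>.\<close>

lemma prob_random_graph_many_uniform_sets:
  assumes "n \<ge> 1"
  shows "measure_pmf.prob (random_graph n (1/2))
           {E. n * count_bound n < card {S \<in> Pow {1..n}. \<forall>e\<in>all_edges S. (e \<in> E) = b}} \<le> 1 / n"
proof -
  have pos: "count_bound n > 0"
    by (simp add: count_bound_def)
  have "measure_pmf.prob (random_graph n (1/2))
      {E. n * count_bound n < card {S \<in> Pow {1..n}. \<forall>e\<in>all_edges S. (e \<in> E) = b}}
      \<le> (\<Sum>S\<in>Pow {1..n}. measure_pmf.prob (random_graph n (1/2))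
            {E. \<forall>e\<in>all_edges S. (e \<in> E) = b}) / (n * count_bound n)"
    using assms pos by (intro prob_card_Markov) auto
  also have "(\<Sum>S\<in>Pow {1..n}. measure_pmf.prob (random_graph n (1/2))
        {E. \<forall>e\<in>all_edges S. (e \<in> E) = b}) = (\<Sum>S\<in>Pow {1..n}. (1/2) ^ (card S choose 2))"
    by (rule sum.cong) (simp_all add: prob_random_graph_uniform_on)
  also have "\<dots> / (n * count_bound n) \<le> count_bound n / (n * count_bound n)"
    using sum_Pow_half_power_le[OF assms] assms pos by (intro divide_right_mono) auto
  also have "\<dots> = 1 / n"
    using pos by simp
  finally show ?thesis .
qed

lemma count_bound_square_le:
  assumes "n \<ge> 2"
  shows "(n * count_bound n)\<^sup>2 \<le> real n powr ((1 + 8 / log 2 n) * log 2 n)"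
proof -
  define L where "L = log 2 (real n)"
  have L: "L \<ge> 1"
    using assms by (simp add: L_def le_log_iff)
  have n: "real n = 2 powr L"
    using assms by (simp add: L_def)
  have "real n + 1 \<le> 2 * real n"
    using assms by simp
  also have "\<dots> = 2 powr (L + 1)"
    by (simp add: n powr_add)
  finally have "n * count_bound n \<le> 2 powr L * (2 powr (L + 1) * 2 powr ((L + 1/2)\<^sup>2 / 2))"
    unfolding count_bound_def L_def[symmetric] by (simp add: n mult_left_mono mult_right_mono)
  also have "\<dots> = 2 powr (2 * L + 1 + (L + 1/2)\<^sup>2 / 2)"
    by (simp add: powr_add[symmetric] add.assoc)
  finally have "(n * count_bound n)\<^sup>2 \<le> (2 powr (2 * L + 1 + (L + 1/2)\<^sup>2 / 2))\<^sup>2"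
    by (rule power_mono) (simp add: count_bound_def)
  also have "\<dots> = 2 powr (4 * L + 2 + (L + 1/2)\<^sup>2)"
    by (simp add: power2_eq_square powr_add[symmetric] add.assoc)
  \<comment> \<open>The left exponent is \<open>L^2 + 5*L + 9/4\<close>, which stays below
    \<open>L^2 + 8*L\<close> because \<open>L \<ge> 1\<close>; hence the constant 8.\<close>
  also have "\<dots> \<le> 2 powr (L * (L + 8))"
    using L by (intro powr_mono) (simp_all add: power2_eq_square algebra_simps)
  also have "L * (L + 8) = L * ((1 + 8 / L) * L)"
    using L by (simp add: distrib_right)
  also have "2 powr \<dots> = real n powr ((1 + 8 / L) * L)"
    by (simp only: n powr_powr)
  finally show ?thesis
    unfolding L_def .
qed

lemma prob_clique_indep_product_le:
  assumes "n \<ge> 2"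
  shows "measure_pmf.prob (random_graph n (1/2))
           {E. real (clique_indep_product {1..n} E) \<le> real n powr ((1 + 8 / log 2 n) * log 2 n)}
         \<ge> 1 - 2 / n"
    (is "measure_pmf.prob ?p ?good \<ge> _")
proof -
  define bad where
    "bad b = {E. n * count_bound n < card {S \<in> Pow {1..n}. \<forall>e\<in>all_edges S. (e \<in> E) = b}}" for b
  \<comment> \<open>Outside both bad events each count is at most \<open>n * count_bound n\<close>,
    so the product is at most its square. The union bound then costs 1/n twice.\<close>
  have "- ?good \<subseteq> bad True \<union> bad False"
  proof (rule ccontr)
    assume "\<not> - ?good \<subseteq> bad True \<union> bad False"
    then obtain E where E: "E \<notin> ?good" "E \<notin> bad True" "E \<notin> bad False"
      by blast
    then have "real (num_cliques {1..n} E) \<le> n * count_bound n"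
      and "real (num_indep {1..n} E) \<le> n * count_bound n"
      by (simp_all add: bad_def num_cliques_def num_indep_def is_clique_iff is_indep_iff)
    then have "real (clique_indep_product {1..n} E) \<le> (n * count_bound n)\<^sup>2"
      unfolding clique_indep_product_def power2_eq_square of_nat_mult
      by (intro mult_mono) (simp_all add: count_bound_def)
    with count_bound_square_le[OF assms] E(1) show False
      by simp
  qed
  then have "measure_pmf.prob ?p (- ?good) \<le> measure_pmf.prob ?p (bad True \<union> bad False)"
    by (intro measure_pmf.finite_measure_mono) auto
  also have "\<dots> \<le> measure_pmf.prob ?p (bad True) + measure_pmf.prob ?p (bad False)"
    by (rule measure_Un_le) auto
  also have "\<dots> \<le> 1 / n + 1 / n"
    unfolding bad_def using assms by (intro add_mono prob_random_graph_many_uniform_sets) auto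
  finally show ?thesis
    using measure_pmf.prob_compl[of ?good ?p] by (simp add: Compl_eq_Diff_UNIV)
qed

theorem proposition1p6:
  "\<exists>\<epsilon> :: nat \<Rightarrow> real. \<epsilon> \<longlonglongrightarrow> 0 \<and>
     (\<lambda>n. measure_pmf.prob (random_graph n (1/2))
        {E. real (clique_indep_product {1..n} E) \<le> real n powr ((1 + \<epsilon> n) * log 2 (real n))})
      \<longlonglongrightarrow> 1"
proof (intro exI conjI)
  \<comment> \<open>The witness spreads the additive constant 8 in the exponent over the leading
    term \<open>log 2 n\<close>. Its default value 0 at \<open>n < 2\<close> does not affect the
    limits.\<close>
  show "(\<lambda>n. 8 / log 2 (real n)) \<longlonglongrightarrow> 0"
    by real_asymp
  show "(\<lambda>n. measure_pmf.prob (random_graph n (1/2))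
      {E. real (clique_indep_product {1..n} E)
            \<le> real n powr ((1 + 8 / log 2 (real n)) * log 2 (real n))}) \<longlonglongrightarrow> 1"
  proof (rule tendsto_sandwich)
    show "(\<lambda>n. 1 - 2 / real n) \<longlonglongrightarrow> 1"
      by real_asymp
    show "\<forall>\<^sub>F n in sequentially. 1 - 2 / real n \<le> measure_pmf.prob (random_graph n (1/2))
        {E. real (clique_indep_product {1..n} E)
              \<le> real n powr ((1 + 8 / log 2 (real n)) * log 2 (real n))}"
      using eventually_ge_at_top[of 2] by eventually_elim (rule prob_clique_indep_product_le)
  qed auto
qed

end
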